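(* Let $F$ be the face $(\hat U_{2,5}^{1},U_{1,3}^{123})$ of $\Gamma_4$. For real $a,b\ge 0$, the point $\mathbf h=(a,b)\in F$ is entropic if and only if $a+b\ge\log\lceil 2^a\rceil$.
   Context: $N_4=\{1,2,3,4\}$. $\Gamma_4$ is the cone of all polymatroid rank functions on $N_4$. A set function $\mathbf h:2^{N_4}\to\mathbb R$ is called entropic if there is a random vector $(X_1,X_2,X_3,X_4)$, each $X_i$ taking values in a finite set, with $\mathbf h(A)=H(X_A)$ for all $A\subseteq N_4$, where $H$ is Shannon entropy, $X_A=(X_j,j\in A)$ and $\mathbf h(\emptyset)=0$. Logarithms (also in the entropy) are to base $2$. For two (poly)matroids $M_1,M_2$ on $N_4$ with rank functions $\mathbf r_1,\mathbf r_2$, $(M_1,M_2)$ denotes the face $\{a\mathbf r_1+b\mathbf r_2:a,b\ge0\}$ of $\Gamma_4$, and $(a,b)$ denotes the point $a\mathbf r_1+b\mathbf r_2$. $U^{123}_{1,3}$ is the matroid on $N_4$ with rank function $\mathbf r(A)=\min\{1,|A\cap\{1,2,3\}|\}$. $\hat U^1_{2,5}$ is the integer polymatroid on $N_4$ with rank function $\mathbf r(A)=\min\{2,|A|\}$ for $A\neq\{1\}$ and $\mathbf r(\{1\})=2$. *)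

theory Defs
  imports "HOL-Probability.Probability"
begin

abbreviation N4 :: "nat set" where
  "N4 \<equiv> {1, 2, 3, 4}"

text \<open>Set functions on the subsets of \<^term>\<open>N4\<close> are functions on \<^typ>\<open>nat set\<close> whose values
  outside \<^term>\<open>Pow N4\<close> are never inspected.\<close>

definition Gamma4 :: "(nat set \<Rightarrow> real) set" where
  "Gamma4 = {r. r {} = 0 \<and>
     (\<forall>A B. A \<subseteq> B \<and> B \<subseteq> N4 \<longrightarrow> r A \<le> r B) \<and>
     (\<forall>A B. A \<subseteq> N4 \<and> B \<subseteq> N4 \<longrightarrow> r (A \<union> B) + r (A \<inter> B) \<le> r A + r B)}"

definition U_1_3_123 :: "nat set \<Rightarrow> real" where
  "U_1_3_123 A = min 1 (real (card (A \<inter> {1, 2, 3})))"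

definition Uhat_2_5_1 :: "nat set \<Rightarrow> real" where
  "Uhat_2_5_1 A = (if A = {1} then 2 else min 2 (real (card A)))"

definition face_point ::
  "(nat set \<Rightarrow> real) \<Rightarrow> (nat set \<Rightarrow> real) \<Rightarrow> real \<Rightarrow> real \<Rightarrow> nat set \<Rightarrow> real" where
  "face_point r1 r2 a b = (\<lambda>A. a * r1 A + b * r2 A)"

definition face2 ::
  "(nat set \<Rightarrow> real) \<Rightarrow> (nat set \<Rightarrow> real) \<Rightarrow> (nat set \<Rightarrow> real) set" where
  "face2 r1 r2 = {h. \<exists>a\<ge>0. \<exists>b\<ge>0. \<forall>A\<subseteq>N4. h A = face_point r1 r2 a b A}"

definition subvector :: "(nat \<Rightarrow> 'w \<Rightarrow> 'v) \<Rightarrow> nat set \<Rightarrow> 'w \<Rightarrow> nat \<Rightarrow> 'v" where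
  "subvector X A = (\<lambda>w. \<lambda>j\<in>A. X j w)"

definition joint_entropy :: "'w measure \<Rightarrow> (nat \<Rightarrow> 'w \<Rightarrow> 'v) \<Rightarrow> nat set \<Rightarrow> real" where
  "joint_entropy M X A =
     prob_space.entropy M 2 (count_space (subvector X A ` space M)) (subvector X A)"

text \<open>A measurable map into a finite discrete set is a \<^const>\<open>simple_function\<close>.
  One cannot quantify over the types of the sample space and of the values; by the lemma
  \<open>entropic_joint_entropy\<close> below, taking both to be \<^typ>\<open>nat\<close> is no restriction.\<close>

definition entropic :: "(nat set \<Rightarrow> real) \<Rightarrow> bool" where
  "entropic h \<longleftrightarrow> (\<exists>(M :: nat measure) (X :: nat \<Rightarrow> nat \<Rightarrow> nat).
     prob_space M \<and> (\<forall>j\<in>N4. simple_function M (X j)) \<and>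
     (\<forall>A\<subseteq>N4. h A = joint_entropy M X A))"

lemma simple_function_subvector:
  assumes "finite A" and X: "\<And>j. j \<in> A \<Longrightarrow> simple_function M (X j)"
  shows "simple_function M (subvector X A)"
  using assms
proof (induction A)
  case empty
  then show ?case by (simp add: subvector_def)
next
  case (insert i A)
  have "simple_function M (subvector X A)" "simple_function M (X i)" using insert by auto
  from simple_function_compose1[OF simple_function_Pair[OF this]]
  have "simple_function M (\<lambda>w. (\<lambda>(f, x). f(i := x)) (subvector X A w, X i w))" .
  also have "(\<lambda>w. (\<lambda>(f, x). f(i := x)) (subvector X A w, X i w)) = subvector X (insert i A)"
    using insert by (auto simp: subvector_def fun_eq_iff)
  finally show ?case .
qed

lemma entropic_joint_entropy:
  fixes M :: "'w measure" and X :: "nat \<Rightarrow> 'w \<Rightarrow> 'v"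
  assumes M: "prob_space M" and X: "\<And>j. j \<in> N4 \<Longrightarrow> simple_function M (X j)"
  shows "entropic (joint_entropy M X)"
proof -
  interpret M: prob_space M by (rule M)
  interpret M: information_space M 2 by standard simp
  define Y where "Y = subvector X N4"
  have Y: "simple_function M Y"
    unfolding Y_def using X by (intro simple_function_subvector) auto
  have finY: "finite (Y ` space M)" using Y by (simp add: simple_function_def)
  obtain g :: "(nat \<Rightarrow> 'v) \<Rightarrow> nat" where g: "inj_on g (Y ` space M)"
    using finite_imp_inj_to_nat_seg[OF finY] by blast
  have finV: "finite (\<Union>j\<in>N4. X j ` space M)" using X by (auto simp: simple_function_def)
  obtain e :: "'v \<Rightarrow> nat" where e: "inj_on e (\<Union>j\<in>N4. X j ` space M)"
    using finite_imp_inj_to_nat_seg[OF finV] by blast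
  define G where "G = g \<circ> Y"
  have G: "simple_function M G" unfolding G_def using Y by auto
  have finG: "finite (G ` space M)" using G by (simp add: simple_function_def)
  have Gm: "G \<in> measurable M (count_space (G ` space M))"
    using G finG by (auto simp: measurable_count_space_eq2 simple_function_def)
  define M' where "M' = distr M (count_space (G ` space M)) G"
  define X' where "X' = (\<lambda>j n. e (the_inv_into (Y ` space M) g n j))"
  have sp: "space M' = G ` space M" by (simp add: M'_def)
  have M': "prob_space M'" unfolding M'_def using Gm by (rule M.prob_space_distr)
  have X'G: "X' j (G w) = e (X j w)" if "w \<in> space M" "j \<in> N4" for w j
    using that g by (auto simp: X'_def G_def the_inv_into_f_f Y_def subvector_def)
  have "simple_function M' (X' j)" for j
    using finG by (auto simp: simple_function_def sp) (auto simp: M'_def)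
  moreover have "joint_entropy M X A = joint_entropy M' X' A" if A: "A \<subseteq> N4" for A
  proof -
    define \<phi> where "\<phi> = (\<lambda>f::nat \<Rightarrow> 'v. \<lambda>j\<in>A. e (f j))"
    have eq: "subvector X' A (G w) = (\<phi> \<circ> subvector X A) w" if "w \<in> space M" for w
      using that A X'G by (auto simp: subvector_def \<phi>_def fun_eq_iff subset_iff)
    have inj: "inj_on \<phi> (subvector X A ` space M)"
    proof (rule inj_onI, clarsimp)
      fix v w assume vw: "v \<in> space M" "w \<in> space M"
        and \<phi>: "\<phi> (subvector X A v) = \<phi> (subvector X A w)"
      have "X j v = X j w" if j: "j \<in> A" for j
      proof (rule inj_onD[OF e])
        show "e (X j v) = e (X j w)"
          using fun_cong[OF \<phi>, of j] j by (simp add: \<phi>_def subvector_def)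
      qed (use vw j A in blast)+
      then show "subvector X A v = subvector X A w" by (auto simp: subvector_def fun_eq_iff)
    qed
    have sX: "simple_function M (subvector X A)"
      using A X by (intro simple_function_subvector) (auto intro: finite_subset)
    have im: "subvector X' A ` space M' = (\<phi> \<circ> subvector X A) ` space M"
      unfolding sp image_image using eq by (intro image_cong) auto
    have "distr M' (count_space (subvector X' A ` space M')) (subvector X' A) =
        distr M (count_space (subvector X' A ` space M')) (subvector X' A \<circ> G)"
      unfolding M'_def using Gm by (intro distr_distr) auto
    also have "\<dots> = distr M (count_space ((\<phi> \<circ> subvector X A) ` space M)) (\<phi> \<circ> subvector X A)"
      unfolding im using eq by (intro distr_cong) auto
    finally have d: "distr M' (count_space (subvector X' A ` space M')) (subvector X' A) = \<dots>" .
    have "joint_entropy M' X' A =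
        M.entropy 2 (count_space ((\<phi> \<circ> subvector X A) ` space M)) (\<phi> \<circ> subvector X A)"
      unfolding joint_entropy_def prob_space.entropy_def[OF M'] M.entropy_def d by (simp only: im)
    also have "\<dots> = joint_entropy M X A"
      unfolding joint_entropy_def by (rule M.entropy_of_inj[OF sX inj])
    finally show ?thesis ..
  qed
  ultimately show ?thesis unfolding entropic_def using M' by blast
qed

text \<open>\<^term>\<open>face2 Uhat_2_5_1 U_1_3_123\<close> is indeed a face of the cone \<^const>\<open>Gamma4\<close>.\<close>

lemma Gamma4_empty: "r \<in> Gamma4 \<Longrightarrow> r {} = 0"
  by (simp add: Gamma4_def)

lemma Gamma4_mono: "r \<in> Gamma4 \<Longrightarrow> A \<subseteq> B \<Longrightarrow> B \<subseteq> N4 \<Longrightarrow> r A \<le> r B"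
  unfolding Gamma4_def mem_Collect_eq by metis

lemma Gamma4_submodular:
  "r \<in> Gamma4 \<Longrightarrow> A \<subseteq> N4 \<Longrightarrow> B \<subseteq> N4 \<Longrightarrow> r (A \<union> B) + r (A \<inter> B) \<le> r A + r B"
  unfolding Gamma4_def mem_Collect_eq by metis

lemma Uhat_2_5_1_Gamma4: "Uhat_2_5_1 \<in> Gamma4"
proof -
  have fin: "finite A" if "A \<subseteq> N4" for A using that by (rule finite_subset) simp
  have le2: "Uhat_2_5_1 A \<le> 2" for A by (simp add: Uhat_2_5_1_def)
  have ge1: "1 \<le> Uhat_2_5_1 A" if "finite A" "A \<noteq> {}" for A
    using that card_gt_0_iff[of A] by (auto simp: Uhat_2_5_1_def)
  have eq2: "Uhat_2_5_1 A = 2" if "card A \<ge> 2" for A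
    using that by (auto simp: Uhat_2_5_1_def)
  have big: "card B \<ge> 2" if "A \<subset> B" "A \<noteq> {}" "finite B" for A B :: "nat set"
  proof -
    have "card A < card B" using that by (intro psubset_card_mono) auto
    moreover have "card A > 0" using that finite_subset[of A B] by (auto simp: card_gt_0_iff)
    ultimately show ?thesis by linarith
  qed
  have empty: "Uhat_2_5_1 {} = 0" by (simp add: Uhat_2_5_1_def)
  have mono: "Uhat_2_5_1 A \<le> Uhat_2_5_1 B" if AB: "A \<subseteq> B" "B \<subseteq> N4" for A B
  proof (cases "A = B \<or> A = {}")
    case True
    then show ?thesis using ge1[OF fin[OF AB(2)]] empty by (cases "B = {}") auto
  next
    case False
    then have "Uhat_2_5_1 B = 2" using AB fin by (intro eq2 big[of A]) auto
    then show ?thesis using le2 by simp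
  qed
  have "Uhat_2_5_1 (A \<union> B) + Uhat_2_5_1 (A \<inter> B) \<le> Uhat_2_5_1 A + Uhat_2_5_1 B"
    if AB: "A \<subseteq> N4" "B \<subseteq> N4" for A B
  proof -
    consider "A \<subseteq> B" | "B \<subseteq> A" | "\<not> A \<subseteq> B" "\<not> B \<subseteq> A" "A \<inter> B = {}"
      | "\<not> A \<subseteq> B" "\<not> B \<subseteq> A" "A \<inter> B \<noteq> {}" by blast
    then show ?thesis
    proof cases
      case 3
      then have "1 \<le> Uhat_2_5_1 A" "1 \<le> Uhat_2_5_1 B" using AB fin by (auto intro!: ge1)
      then show ?thesis using le2[of "A \<union> B"] empty 3 by simp
    next
      case 4
      then have "Uhat_2_5_1 A = 2" "Uhat_2_5_1 B = 2"
        using AB fin by (auto intro!: eq2 big[of "A \<inter> B"])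
      then show ?thesis using le2[of "A \<union> B"] le2[of "A \<inter> B"] by simp
    qed (auto simp: Un_absorb1 Un_absorb2 Int_absorb1 Int_absorb2)
  qed
  then show ?thesis unfolding Gamma4_def mem_Collect_eq using empty mono by metis
qed

lemma U_1_3_123_Gamma4: "U_1_3_123 \<in> Gamma4"
proof -
  have "U_1_3_123 A = of_bool (A \<inter> {1, 2, 3} \<noteq> {})" for A
    using card_gt_0_iff[of "A \<inter> {1, 2, 3}"] by (auto simp: U_1_3_123_def min_def)
  then have eq: "U_1_3_123 = (\<lambda>A. of_bool (A \<inter> {1, 2, 3} \<noteq> {}))" by blast
  show ?thesis unfolding Gamma4_def eq by (auto simp: of_bool_def)
qed

lemma face2_subset_Gamma4: "face2 Uhat_2_5_1 U_1_3_123 \<subseteq> Gamma4"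
proof
  fix h assume "h \<in> face2 Uhat_2_5_1 U_1_3_123"
  then obtain a b where ab: "a \<ge> 0" "b \<ge> 0"
    and h: "\<And>A. A \<subseteq> N4 \<Longrightarrow> h A = a * Uhat_2_5_1 A + b * U_1_3_123 A"
    by (auto simp: face2_def face_point_def)
  note G = Uhat_2_5_1_Gamma4 U_1_3_123_Gamma4
  have "h {} = 0" using Gamma4_empty[OF G(1)] Gamma4_empty[OF G(2)] h[of "{}"] by simp
  moreover have "h A \<le> h B" if "A \<subseteq> B" "B \<subseteq> N4" for A B
  proof -
    have "a * Uhat_2_5_1 A + b * U_1_3_123 A \<le> a * Uhat_2_5_1 B + b * U_1_3_123 B"
      by (intro add_mono mult_left_mono Gamma4_mono G that ab)
    then show ?thesis using h[OF that(2)] h[OF order_trans[OF that]] by simp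
  qed
  moreover have "h (A \<union> B) + h (A \<inter> B) \<le> h A + h B" if "A \<subseteq> N4" "B \<subseteq> N4" for A B
  proof -
    have "a * (Uhat_2_5_1 (A \<union> B) + Uhat_2_5_1 (A \<inter> B)) \<le> a * (Uhat_2_5_1 A + Uhat_2_5_1 B)"
      "b * (U_1_3_123 (A \<union> B) + U_1_3_123 (A \<inter> B)) \<le> b * (U_1_3_123 A + U_1_3_123 B)"
      by (intro mult_left_mono Gamma4_submodular G that ab)+
    moreover have "A \<union> B \<subseteq> N4" "A \<inter> B \<subseteq> N4" using that by blast+
    ultimately show ?thesis using that by (simp only: h distrib_left)
  qed
  ultimately show "h \<in> Gamma4" unfolding Gamma4_def by blast
qed

lemma all_subset_N4:
  "(\<forall>A\<subseteq>N4. P A) \<longleftrightarrow> P {} \<and> P {1} \<and> P {2} \<and> P {3} \<and> P {4} \<and> P {1,2} \<and> P {1,3} \<and> P {1,4} \<and>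
     P {2,3} \<and> P {2,4} \<and> P {3,4} \<and> P {1,2,3} \<and> P {1,2,4} \<and> P {1,3,4} \<and> P {2,3,4} \<and> P N4"
  (is "_ \<longleftrightarrow> ?R")
proof -
  have "(\<forall>A\<subseteq>N4. P A) \<longleftrightarrow> (\<forall>A\<in>Pow N4. P A)" by blast
  also have "\<dots> \<longleftrightarrow> ?R"
    unfolding Pow_insert Pow_empty image_insert image_empty Un_insert_left Un_empty_left
    by (simp only: Set.ball_simps simp_thms) (intro iffI; elim conjE; intro conjI; assumption)
  finally show ?thesis .
qed

lemma face2_is_face:
  assumes x: "x \<in> Gamma4" and y: "y \<in> Gamma4"
    and xy: "(\<lambda>A. x A + y A) \<in> face2 Uhat_2_5_1 U_1_3_123"
  shows "x \<in> face2 Uhat_2_5_1 U_1_3_123"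
proof -
  obtain a b where ab: "\<forall>A\<subseteq>N4. x A + y A = a * Uhat_2_5_1 A + b * U_1_3_123 A"
    using xy by (auto simp: face2_def face_point_def)
  have s: "x {} + y {} = 0" "x {1} + y {1} = 2*a + b" "x {2} + y {2} = a + b"
    "x {3} + y {3} = a + b" "x {4} + y {4} = a"
    "x {1,2} + y {1,2} = 2*a + b" "x {1,3} + y {1,3} = 2*a + b" "x {1,4} + y {1,4} = 2*a + b"
    "x {2,3} + y {2,3} = 2*a + b" "x {2,4} + y {2,4} = 2*a + b" "x {3,4} + y {3,4} = 2*a + b"
    "x {1,2,3} + y {1,2,3} = 2*a + b" "x {1,2,4} + y {1,2,4} = 2*a + b"
    "x {1,3,4} + y {1,3,4} = 2*a + b" "x {2,3,4} + y {2,3,4} = 2*a + b" "x N4 + y N4 = 2*a + b"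
    using ab[unfolded all_subset_N4]
    by (auto simp: Uhat_2_5_1_def U_1_3_123_def Int_insert_left)
  have mono: "r A \<le> r N4" if "r \<in> Gamma4" "A \<subseteq> N4" for r A
    by (rule Gamma4_mono[OF that order_refl])
  note sub = Gamma4_submodular and zero = Gamma4_empty
  have nonneg: "0 \<le> r {4}" if "r \<in> Gamma4" for r
  proof -
    have "r {} \<le> r {4}" by (rule Gamma4_mono[OF that]) auto
    then show ?thesis using zero[OF that] by simp
  qed
  have top: "x A = x N4" if "A \<subseteq> N4" "x A + y A = 2*a + b" for A
    using mono[OF x that(1)] mono[OF y that(1)] that(2) s(16) by linarith
  have t: "x {1} = x N4" "x {1,2} = x N4" "x {1,3} = x N4" "x {1,4} = x N4"
    "x {2,3} = x N4" "x {2,4} = x N4" "x {3,4} = x N4" "x {1,2,3} = x N4" "x {1,2,4} = x N4"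
    "x {1,3,4} = x N4" "x {2,3,4} = x N4"
    by (rule top; use s in simp)+
  have m2: "r {2,4} \<le> r {2} + r {4}" and m3: "r {3,4} \<le> r {3} + r {4}"
    and m23: "r {2,3} \<le> r {2} + r {3}" if r: "r \<in> Gamma4" for r
    using sub[OF r, of "{2}" "{4}"] sub[OF r, of "{3}" "{4}"] sub[OF r, of "{2}" "{3}"] zero[OF r]
    by (simp_all add: insert_commute)
  have x2: "x {2} = x N4 - x {4}" using m2[OF x] m2[OF y] s t by linarith
  have x3: "x {3} = x N4 - x {4}" using m3[OF x] m3[OF y] s t by linarith
  have b: "0 \<le> x N4 - 2 * x {4}" using m23[OF x] x2 x3 t by linarith
  have "\<forall>A\<subseteq>N4. x A = face_point Uhat_2_5_1 U_1_3_123 (x {4}) (x N4 - 2 * x {4}) A"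
    unfolding all_subset_N4 face_point_def using t x2 x3 zero[OF x]
    by (auto simp: Uhat_2_5_1_def U_1_3_123_def Int_insert_left)
  then show ?thesis unfolding face2_def using nonneg[OF x] b by blast
qed

end

theory Submission
  imports Defs "HOL-Real_Asymp.Real_Asymp"
begin

text \<open>Any two of \<open>X\<^sub>2, X\<^sub>3, X\<^sub>4\<close> determine all four variables, and \<open>X\<^sub>4\<close> has entropy \<open>a\<close> and is
  independent of \<open>X\<^sub>2\<close> and of \<open>X\<^sub>3\<close>, both of entropy \<open>a + b\<close>. Hence jointly possible values of
  \<open>X\<^sub>2\<close> and \<open>X\<^sub>3\<close> are equally likely, and each value of \<open>X\<^sub>2\<close> is compatible with as many values
  of \<open>X\<^sub>3\<close> as \<open>X\<^sub>4\<close> has values, say \<open>k\<close>. So the values of \<open>X\<^sub>2\<close> have probability at most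
  \<open>1 / k\<close>, whence \<open>a + b \<ge> log 2 k\<close>, while \<open>a \<le> log 2 k\<close> forces \<open>k \<ge> \<lceil>2 powr a\<rceil>\<close>.
  Conversely, let \<open>k = \<lceil>2 powr a\<rceil>\<close>, let \<open>X\<^sub>4\<close> have entropy \<open>a\<close> on \<open>k\<close> values, and shift a
  uniform variable modulo \<open>k\<close> by it; an independent variable common to \<open>X\<^sub>2\<close> and \<open>X\<^sub>3\<close> supplies
  the entropy \<open>a + b - log 2 k\<close> still missing.\<close>

section \<open>Entropy of a function on a finite probability space\<close>

text \<open>\<open>mass S p f w\<close> is the probability of the value \<open>f w\<close>, as a function of the outcome \<open>w\<close>: so
  \<open>ent\<close> sums over outcomes, and depends on \<open>f\<close> only through the partition that it induces.\<close>

definition mass :: "'w set \<Rightarrow> ('w \<Rightarrow> real) \<Rightarrow> ('w \<Rightarrow> 'v) \<Rightarrow> 'w \<Rightarrow> real" where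
  "mass S p f w = sum p {w' \<in> S. f w' = f w}"

definition ent :: "'w set \<Rightarrow> ('w \<Rightarrow> real) \<Rightarrow> ('w \<Rightarrow> 'v) \<Rightarrow> real" where
  "ent S p f = - (\<Sum>w\<in>S. p w * log 2 (mass S p f w))"

lemma ent_cong:
  assumes "\<And>v w. v \<in> S \<Longrightarrow> w \<in> S \<Longrightarrow> f v = f w \<longleftrightarrow> g v = g w"
  shows "ent S p f = ent S p g"
proof -
  have "mass S p f w = mass S p g w" if "w \<in> S" for w
    using assms that unfolding mass_def by (intro sum.cong) auto
  then show ?thesis unfolding ent_def by simp
qed

lemma ent_const:
  assumes "sum p S = 1" and "\<And>v w. v \<in> S \<Longrightarrow> w \<in> S \<Longrightarrow> f v = f w"
  shows "ent S p f = 0"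
proof -
  have "mass S p f w = 1" if "w \<in> S" for w
  proof -
    have "{w' \<in> S. f w' = f w} = S" using assms(2) that by blast
    then show ?thesis using assms(1) by (simp add: mass_def)
  qed
  then show ?thesis unfolding ent_def by simp
qed

text \<open>Outcomes are grouped into the fibres of \<open>f\<close>, on which
  \<open>g (f w)\<close> is constant. With a logarithm for \<open>g\<close>, this turns the sum over
  outcomes in \<open>ent\<close> into the usual sum over values.\<close>

lemma sum_image_mass:
  fixes p :: "'w \<Rightarrow> real"
  assumes "finite S"
  shows "(\<Sum>w\<in>S. p w * g (f w)) = (\<Sum>y\<in>f ` S. sum p {w \<in> S. f w = y} * g y)"
proof -
  have "(\<Sum>w\<in>S. p w * g (f w)) = (\<Sum>y\<in>f ` S. \<Sum>w\<in>{w \<in> S. f w = y}. p w * g (f w))"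
    by (rule sum.image_gen[OF assms])
  also have "\<dots> = (\<Sum>y\<in>f ` S. sum p {w \<in> S. f w = y} * g y)"
  proof (intro sum.cong refl)
    fix y
    have "(\<Sum>w\<in>{w \<in> S. f w = y}. p w * g (f w)) = (\<Sum>w\<in>{w \<in> S. f w = y}. p w * g y)"
      by (intro sum.cong) auto
    then show "(\<Sum>w\<in>{w \<in> S. f w = y}. p w * g (f w)) = sum p {w \<in> S. f w = y} * g y"
      by (simp only: sum_distrib_right)
  qed
  finally show ?thesis .
qed

lemma ent_image:
  assumes "finite S"
  shows "ent S p f =
    - (\<Sum>y\<in>f ` S. sum p {w \<in> S. f w = y} * log 2 (sum p {w \<in> S. f w = y}))"
  unfolding ent_def mass_def
  using sum_image_mass[OF assms, of p "\<lambda>y. log 2 (sum p {w \<in> S. f w = y})" f] by simp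

text \<open>Null outcomes contribute neither to a mass nor to the sum, so they may be dropped to
  make \<open>p\<close> strictly positive.\<close>

lemma ent_support:
  assumes "finite S"
  shows "ent {w \<in> S. p w \<noteq> 0} p f = ent S p f"
proof -
  have "mass {w \<in> S. p w \<noteq> 0} p f w = mass S p f w" for w
    unfolding mass_def using assms by (intro sum.mono_neutral_left) auto
  then show ?thesis
    unfolding ent_def using assms by (auto intro!: sum.mono_neutral_left)
qed

section \<open>Translation between \<open>entropic\<close> and \<open>ent\<close>\<close>

text \<open>All variables are functions of the finite-valued \<open>W\<close>, so the law of
  \<open>W\<close> carries all their entropies. \<open>W\<close> is the full vector when leaving
  measure theory and the identity when returning to it.\<close>

lemma joint_entropy_eq_ent:
  fixes M :: "'w measure"
  assumes M: "prob_space M" and W: "simple_function M W" and A: "finite A"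
    and X: "\<And>j w. j \<in> A \<Longrightarrow> w \<in> space M \<Longrightarrow> X j w = Z j (W w)"
  shows "joint_entropy M X A =
    ent (W ` space M) (\<lambda>v. measure M (W -` {v} \<inter> space M)) (\<lambda>v. \<lambda>j\<in>A. Z j v)"
proof -
  interpret M: prob_space M by (rule M)
  interpret M: information_space M 2 by standard simp
  define S where "S = W ` space M"
  define p where "p = (\<lambda>v. measure M (W -` {v} \<inter> space M))"
  define f where "f = (\<lambda>v. \<lambda>j\<in>A. Z j v)"
  have finS: "finite S" using W by (simp add: S_def simple_function_def)
  have sub: "subvector X A w = f (W w)" if "w \<in> space M" for w
    using that X by (auto simp: subvector_def f_def fun_eq_iff)
  have "simple_function M (\<lambda>w. f (W w))" using W by (rule simple_function_compose1)
  then have sX: "simple_function M (subvector X A)"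
    using simple_function_cong[of M "subvector X A" "\<lambda>w. f (W w)"] sub by simp
  have im: "subvector X A ` space M = f ` S" using sub by (auto simp: S_def image_iff)
  have pr: "measure M (subvector X A -` {y} \<inter> space M) = sum p {v \<in> S. f v = y}" for y
  proof -
    have "subvector X A -` {y} \<inter> space M = (\<Union>v\<in>{v \<in> S. f v = y}. W -` {v} \<inter> space M)"
      using sub by (auto simp: S_def)
    also have "measure M \<dots> = (\<Sum>v\<in>{v \<in> S. f v = y}. measure M (W -` {v} \<inter> space M))"
      using finS simple_functionD[OF W]
      by (intro M.finite_measure_finite_Union) (auto simp: disjoint_family_on_def)
    finally show ?thesis by (simp add: p_def)
  qed
  have "joint_entropy M X A =
      - (\<Sum>y\<in>f ` S. sum p {v \<in> S. f v = y} * log 2 (sum p {v \<in> S. f v = y}))"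
    unfolding joint_entropy_def
    using M.entropy_simple_distributed[OF M.simple_distributedI[OF sX measure_nonneg refl]]
    by (simp only: pr im)
  also have "\<dots> = ent S p f" by (rule ent_image[OF finS, symmetric])
  finally show ?thesis unfolding S_def p_def f_def .
qed

lemma entropic_cong:
  assumes "\<And>A. A \<subseteq> N4 \<Longrightarrow> h A = g A"
  shows "entropic h \<longleftrightarrow> entropic g"
  unfolding entropic_def using assms by (simp only: cong: imp_cong)

text \<open>The outcomes become the vectors of positive probability themselves, so the four
  coordinates together identify an outcome.\<close>

lemma entropic_finite_support:
  assumes "entropic h"
  obtains S :: "(nat \<Rightarrow> nat) set" and p :: "(nat \<Rightarrow> nat) \<Rightarrow> real"
  where "finite S" "\<And>v. v \<in> S \<Longrightarrow> p v > 0" "sum p S = 1"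
    "\<And>v w. v \<in> S \<Longrightarrow> w \<in> S \<Longrightarrow> (\<And>j. j \<in> N4 \<Longrightarrow> v j = w j) \<Longrightarrow> v = w"
    "\<And>A. A \<subseteq> N4 \<Longrightarrow> h A = ent S p (\<lambda>v. \<lambda>j\<in>A. v j)"
proof -
  obtain M :: "nat measure" and X :: "nat \<Rightarrow> nat \<Rightarrow> nat"
    where M: "prob_space M" and "\<forall>j\<in>N4. simple_function M (X j)"
      and "\<forall>A\<subseteq>N4. h A = joint_entropy M X A"
    using assms unfolding entropic_def by (elim exE conjE)
  then have X: "\<And>j. j \<in> N4 \<Longrightarrow> simple_function M (X j)"
    and h: "\<And>A. A \<subseteq> N4 \<Longrightarrow> h A = joint_entropy M X A" by (auto simp only:)
  interpret M: prob_space M by (rule M)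
  define W where "W = subvector X N4"
  have W: "simple_function M W"
    unfolding W_def using X by (intro simple_function_subvector) auto
  define p where "p v = measure M (W -` {v} \<inter> space M)" for v
  define T where "T = W ` space M"
  define S where "S = {v \<in> T. p v \<noteq> 0}"
  have finT: "finite T" using W by (simp add: T_def simple_function_def)
  have "sum p T = measure M (\<Union>v\<in>T. W -` {v} \<inter> space M)"
    unfolding p_def using finT simple_functionD[OF W]
    by (intro M.finite_measure_finite_Union[symmetric]) (auto simp: disjoint_family_on_def)
  also have "(\<Union>v\<in>T. W -` {v} \<inter> space M) = space M" by (auto simp: T_def)
  finally have sumT: "sum p T = 1" by (simp add: M.prob_space)
  show ?thesis
  proof
    show "finite S" using finT by (simp add: S_def)
    show "p v > 0" if "v \<in> S" for v
      using that measure_nonneg[of M "W -` {v} \<inter> space M"] by (simp add: S_def p_def less_le)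
    have "sum p S = sum p T" unfolding S_def using finT by (intro sum.mono_neutral_left) auto
    then show "sum p S = 1" using sumT by simp
    show "v = w" if vw: "v \<in> S" "w \<in> S" and eq: "\<And>j. j \<in> N4 \<Longrightarrow> v j = w j" for v w
    proof
      fix j
      \<comment> \<open>Vectors in \<open>S\<close> come from \<open>subvector\<close> and hence
        take the default value \<open>undefined\<close> off \<open>N4\<close>; agreement on
        \<open>N4\<close> is therefore equality.\<close>
      have undef: "u j = undefined" if "u \<in> S" "j \<notin> N4" for u
      proof -
        obtain x where "u = W x" using \<open>u \<in> S\<close> by (auto simp only: S_def T_def)
        then show ?thesis using \<open>j \<notin> N4\<close> by (simp only: W_def subvector_def restrict_apply if_False)
      qed
      have "v j = w j" if "j \<notin> N4" using undef[OF vw(1) that] undef[OF vw(2) that] by simp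
      then show "v j = w j" using eq[of j] by (cases "j \<in> N4") simp_all
    qed
    show "h A = ent S p (\<lambda>v. \<lambda>j\<in>A. v j)" if A: "A \<subseteq> N4" for A
    proof -
      have "joint_entropy M X A = ent T p (\<lambda>v. \<lambda>j\<in>A. v j)"
        unfolding T_def p_def using A finite_subset[OF A]
        by (intro joint_entropy_eq_ent[OF M W]) (auto simp: W_def subvector_def)
      then show ?thesis using h[OF A] by (simp add: S_def ent_support[OF finT])
    qed
  qed
qed

text \<open>Null outcomes are allowed here because the distributions used in the construction below
  may vanish at some points.\<close>

lemma entropic_ent:
  fixes S :: "'w set" and Z :: "nat \<Rightarrow> 'w \<Rightarrow> 'v"
  assumes S: "finite S" and p: "\<And>v. v \<in> S \<Longrightarrow> p v \<ge> 0" "sum p S = 1"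
    and h: "\<And>A. A \<subseteq> N4 \<Longrightarrow> h A = ent S p (\<lambda>v. \<lambda>j\<in>A. Z j v)"
  shows "entropic h"
proof -
  define M where "M = point_measure S (\<lambda>v. ennreal (p v))"
  have M: "prob_space M" unfolding M_def using S p
    by (intro prob_space_point_measure) (auto simp: sum_ennreal)
  have sp: "space M = S" by (simp add: M_def space_point_measure)
  have sf: "simple_function M f" for f :: "'w \<Rightarrow> 'x"
    using S by (simp add: M_def)
  have pr: "measure M {v} = p v" if "v \<in> S" for v
    using that S p by (simp add: M_def measure_point_measure_finite_if)
  have "h A = joint_entropy M Z A" if A: "A \<subseteq> N4" for A
  proof -
    have "joint_entropy M Z A = ent S (\<lambda>v. measure M ((\<lambda>v. v) -` {v} \<inter> S)) (\<lambda>v. \<lambda>j\<in>A. Z j v)"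
      using joint_entropy_eq_ent[OF M sf[of "\<lambda>v. v"], of A Z Z] finite_subset[OF A]
      by (simp add: sp)
    also have "\<dots> = ent S p (\<lambda>v. \<lambda>j\<in>A. Z j v)"
      unfolding ent_def mass_def using pr by (auto intro!: sum.cong arg_cong[where f = "log 2"])
    finally show ?thesis using h[OF A] by simp
  qed
  moreover have "entropic (joint_entropy M Z)"
    using sf by (intro entropic_joint_entropy[OF M])
  ultimately show ?thesis using entropic_cong[of h "joint_entropy M Z"] by simp
qed

section \<open>Gibbs' inequality and its equality case\<close>

text \<open>For \<open>x > 0\<close> this is \<open>ln t \<le> t - 1\<close> at
  \<open>t = y / x\<close>, multiplied by \<open>x\<close>, with equality only at
  \<open>t = 1\<close>. For \<open>x = 0\<close> the left side is 0.\<close>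

lemma log2_gibbs_term:
  assumes "(x::real) \<ge> 0" "y \<ge> 0" "x > 0 \<Longrightarrow> y > 0"
  shows "x * log 2 y - x * log 2 x \<le> (y - x) / ln 2"
    and "x * log 2 y - x * log 2 x = (y - x) / ln 2 \<Longrightarrow> x = y"
proof -
  have *: "x * log 2 y - x * log 2 x \<le> (y - x) / ln 2 \<and>
      (x * log 2 y - x * log 2 x = (y - x) / ln 2 \<longrightarrow> x = y)"
  proof (cases "x = 0")
    case False
    then have x: "x > 0" and y: "y > 0" using assms by auto
    have e: "x * log 2 y - x * log 2 x = x * ln (y / x) / ln 2"
      using x y by (simp add: log_def ln_div field_simps)
    have r: "x * (y / x - 1) = y - x" using x by (simp add: field_simps)
    have "ln (y / x) \<le> y / x - 1" using x y by (intro ln_le_minus_one) simp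
    then have "x * ln (y / x) \<le> x * (y / x - 1)" using x by (intro mult_left_mono) auto
    then have 1: "x * ln (y / x) \<le> y - x" by (simp only: r)
    have 2: "x = y" if "x * ln (y / x) = y - x"
    proof -
      have "x * ln (y / x) = x * (y / x - 1)" using that r by simp
      then have "ln (y / x) = y / x - 1" using x by simp
      then have "y / x = 1" using x y by (intro ln_eq_minus_one) auto
      then show ?thesis using x by simp
    qed
    show ?thesis unfolding e using 1 2 by (auto intro: divide_right_mono)
  qed (use assms in auto)
  show "x * log 2 y - x * log 2 x \<le> (y - x) / ln 2" using * by blast
  show "x * log 2 y - x * log 2 x = (y - x) / ln 2 \<Longrightarrow> x = y" using * by blast
qed

text \<open>The termwise bounds are summed, with slacks \<open>d i \<ge> 0\<close>. If the two sums
  agree, the total slack is \<open>(sum y I - sum x I) / ln 2 \<le> 0\<close>, so every slack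
  vanishes.\<close>

lemma gibbs_inequality:
  fixes x y :: "'i \<Rightarrow> real"
  assumes I: "finite I" and pos: "\<And>i. i \<in> I \<Longrightarrow> x i \<ge> 0" "\<And>i. i \<in> I \<Longrightarrow> y i \<ge> 0"
      "\<And>i. i \<in> I \<Longrightarrow> x i > 0 \<Longrightarrow> y i > 0"
    and le: "sum y I \<le> sum x I"
  shows "(\<Sum>i\<in>I. x i * log 2 (y i)) \<le> (\<Sum>i\<in>I. x i * log 2 (x i))"
    and "(\<Sum>i\<in>I. x i * log 2 (y i)) = (\<Sum>i\<in>I. x i * log 2 (x i)) \<Longrightarrow> i \<in> I \<Longrightarrow> x i = y i"
proof -
  define d where "d i = (y i - x i) / ln 2 - (x i * log 2 (y i) - x i * log 2 (x i))" for i
  have d: "d i \<ge> 0" if "i \<in> I" for i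
    using log2_gibbs_term(1)[of "x i" "y i"] pos that by (simp add: d_def)
  have s: "sum d I = (sum y I - sum x I) / ln 2 -
      ((\<Sum>i\<in>I. x i * log 2 (y i)) - (\<Sum>i\<in>I. x i * log 2 (x i)))"
    unfolding d_def by (simp add: sum_subtractf flip: sum_divide_distrib)
  have neg: "(sum y I - sum x I) / ln 2 \<le> 0" using le by (simp add: divide_le_0_iff)
  have s0: "sum d I \<ge> 0" using d by (rule sum_nonneg)
  show "(\<Sum>i\<in>I. x i * log 2 (y i)) \<le> (\<Sum>i\<in>I. x i * log 2 (x i))" using s s0 neg by linarith
  assume eq: "(\<Sum>i\<in>I. x i * log 2 (y i)) = (\<Sum>i\<in>I. x i * log 2 (x i))" and i: "i \<in> I"
  then have "sum d I = 0" using s s0 neg by linarith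
  then have "d i = 0" using sum_nonneg_eq_0_iff[OF I, of d] d i by blast
  then show "x i = y i" using log2_gibbs_term(2)[of "x i" "y i"] pos i by (simp add: d_def)
qed

section \<open>Entropy bounds and equality cases under full support\<close>

text \<open>Full support makes all masses at outcomes positive and lets equality of entropies force
  identities at every outcome, not just almost surely.\<close>

locale finite_pmf =
  fixes S :: "'w set" and p :: "'w \<Rightarrow> real"
  assumes finite_S: "finite S" and p_pos: "w \<in> S \<Longrightarrow> p w > 0" and sum_p: "sum p S = 1"
begin

lemma S_nonempty: "S \<noteq> {}"
  using sum_p by auto

lemma mass_pos: "w \<in> S \<Longrightarrow> mass S p f w > 0"
  unfolding mass_def using finite_S p_pos by (intro sum_pos) auto

lemma sum_image_eq_1: "(\<Sum>y\<in>f ` S. sum p {w \<in> S. f w = y}) = 1"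
  using sum.image_gen[OF finite_S, of p f] sum_p by simp

text \<open>Gibbs' inequality against the uniform distribution on the values of
  \<open>f\<close>.\<close>

lemma ent_le_log_card: "ent S p f \<le> log 2 (card (f ` S))"
proof -
  define n where "n = card (f ` S)"
  have n: "n > 0" unfolding n_def using finite_S S_nonempty by (simp add: card_gt_0_iff)
  have "(\<Sum>y\<in>f ` S. sum p {w \<in> S. f w = y} * log 2 (1 / n)) \<le>
      (\<Sum>y\<in>f ` S. sum p {w \<in> S. f w = y} * log 2 (sum p {w \<in> S. f w = y}))"
    using finite_S n sum_image_eq_1[of f]
    by (intro gibbs_inequality(1)) (auto intro!: sum_nonneg less_imp_le[OF p_pos] simp: n_def)
  then have "log 2 (1 / n) \<le> - ent S p f"
    by (simp add: ent_image[OF finite_S] sum_image_eq_1 flip: sum_distrib_right)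
  then show ?thesis using n by (simp add: log_divide n_def)
qed

lemma ent_ge_log:
  assumes "k > 0" and "\<And>w. w \<in> S \<Longrightarrow> k * mass S p f w \<le> 1"
  shows "log 2 k \<le> ent S p f"
proof -
  have "(\<Sum>w\<in>S. p w * log 2 (mass S p f w)) \<le> (\<Sum>w\<in>S. p w * (- log 2 k))"
  proof (intro sum_mono mult_left_mono)
    fix w assume w: "w \<in> S"
    have "log 2 (k * mass S p f w) \<le> log 2 1"
      using assms w mass_pos[OF w, of f] by (subst log_le_cancel_iff) auto
    then show "log 2 (mass S p f w) \<le> - log 2 k"
      using assms mass_pos[OF w, of f] by (simp add: log_mult)
    show "0 \<le> p w" using p_pos[OF w] by simp
  qed
  also have "\<dots> = - log 2 k" unfolding sum_distrib_right[symmetric] sum_p by simp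
  finally show ?thesis by (simp add: ent_def)
qed

text \<open>Fibres of \<open>f\<close> lie inside fibres of \<open>g\<close>, so the masses compare
  pointwise and equal entropies make them equal. A strictly smaller fibre would lose positive mass.
  It is applied with \<open>f\<close> the full vector and \<open>g\<close> a pair of
  coordinates.\<close>

lemma ent_eq_imp_determines:
  assumes eq: "ent S p f = ent S p g"
    and finer: "\<And>v w. v \<in> S \<Longrightarrow> w \<in> S \<Longrightarrow> f v = f w \<Longrightarrow> g v = g w"
    and vw: "v \<in> S" "w \<in> S" "g v = g w"
  shows "f v = f w"
proof -
  define d where "d w = p w * (log 2 (mass S p g w) - log 2 (mass S p f w))" for w
  have sub: "{w' \<in> S. f w' = f w} \<subseteq> {w' \<in> S. g w' = g w}" if "w \<in> S" for w
    using finer that by blast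
  have le: "mass S p f w \<le> mass S p g w" if "w \<in> S" for w
    unfolding mass_def using finite_S p_pos sub[OF that]
    by (intro sum_mono2) (auto intro: less_imp_le)
  have d: "d w \<ge> 0" if "w \<in> S" for w
    unfolding d_def using le[OF that] mass_pos[OF that, of f] mass_pos[OF that, of g] p_pos[OF that]
    by (intro mult_nonneg_nonneg) auto
  have "sum d S = 0"
    using eq unfolding ent_def d_def by (simp add: right_diff_distrib sum_subtractf)
  then have "d w = 0" using sum_nonneg_eq_0_iff[OF finite_S, of d] d vw by blast
  then have "log 2 (mass S p g w) = log 2 (mass S p f w)"
    using p_pos[OF vw(2)] by (simp add: d_def)
  then have m: "mass S p g w = mass S p f w"
    using mass_pos[OF vw(2), of f] mass_pos[OF vw(2), of g]
    by (simp add: log_def)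
  show ?thesis
  proof (rule ccontr)
    assume "f v \<noteq> f w"
    then have "mass S p f w < mass S p g w"
      unfolding mass_def using vw finite_S p_pos sub[OF vw(2)]
      by (intro sum_strict_mono2[of _ _ v]) (auto intro: less_imp_le)
    then show False using m by simp
  qed
qed

text \<open>Equality case of Gibbs' inequality, with \<open>x\<close> the joint law of
  \<open>f\<close> and \<open>g\<close> and \<open>y\<close> the product of their marginals.\<close>

lemma ent_additive_imp_product:
  assumes eq: "ent S p (\<lambda>w. (f w, g w)) = ent S p f + ent S p g" and v: "v \<in> S" "w \<in> S"
  shows "sum p {u \<in> S. f u = f v \<and> g u = g w} = mass S p f v * mass S p g w"
proof -
  define x where "x = (\<lambda>(a, b). sum p {u \<in> S. (f u, g u) = (a, b)})"
  define y where "y = (\<lambda>(a, b). sum p {u \<in> S. f u = a} * sum p {u \<in> S. g u = b})"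
  define h where "h w = (f w, g w)" for w
  \<comment> \<open>All pairs of values are included, even those that might never occur jointly:
    \<open>f v\<close> and \<open>g w\<close> come from different outcomes, and the product formula
    is what shows that such a pair does occur.\<close>
  define I where "I = f ` S \<times> g ` S"
  have I: "finite I" using finite_S by (simp add: I_def)
  have hI: "h ` S \<subseteq> I" by (auto simp: h_def I_def)
  have xh: "x i = sum p {u \<in> S. h u = i}" for i by (cases i) (simp add: x_def h_def)
  have x0: "x i = 0" if "i \<notin> h ` S" for i
  proof -
    have "{u \<in> S. h u = i} = {}" using that by auto
    then show ?thesis unfolding xh by (simp only: sum.empty)
  qed
  have ypos: "y i > 0" if "i \<in> I" for i
    using that finite_S p_pos by (auto simp: I_def y_def intro!: mult_pos_pos sum_pos)
  have "sum x I = sum x (h ` S)"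
    using x0 by (intro sum.mono_neutral_right[OF I hI]) auto
  also have "\<dots> = 1" unfolding xh by (rule sum_image_eq_1)
  finally have sx: "sum x I = 1" .
  have sy: "sum y I = 1"
  proof -
    have "sum y I = (\<Sum>a\<in>f ` S. \<Sum>b\<in>g ` S. sum p {u \<in> S. f u = a} * sum p {u \<in> S. g u = b})"
      by (simp only: I_def y_def sum.cartesian_product)
    also have "\<dots> = (\<Sum>a\<in>f ` S. sum p {u \<in> S. f u = a}) * (\<Sum>b\<in>g ` S. sum p {u \<in> S. g u = b})"
      by (rule sum_product[symmetric])
    finally show ?thesis by (simp only: sum_image_eq_1 mult_1)
  qed
  have ent_h: "(\<Sum>i\<in>I. x i * log 2 (x i)) = - ent S p h"
  proof -
    have "(\<Sum>i\<in>I. x i * log 2 (x i)) = (\<Sum>i\<in>h ` S. x i * log 2 (x i))"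
      using x0 by (intro sum.mono_neutral_right[OF I hI]) auto
    then show ?thesis by (simp add: ent_image[OF finite_S] xh)
  qed
  have "(\<Sum>i\<in>I. x i * log 2 (y i)) = (\<Sum>i\<in>h ` S. x i * log 2 (y i))"
    using x0 by (intro sum.mono_neutral_right[OF I hI]) auto
  also have "\<dots> = (\<Sum>w\<in>S. p w * log 2 (y (h w)))"
    using sum_image_mass[OF finite_S, of p "\<lambda>i. log 2 (y i)" h] by (simp add: xh)
  also have "\<dots> = (\<Sum>w\<in>S. p w * (log 2 (mass S p f w) + log 2 (mass S p g w)))"
  proof (intro sum.cong refl)
    fix w assume w: "w \<in> S"
    have "y (h w) = mass S p f w * mass S p g w" by (simp add: y_def h_def mass_def)
    then show "p w * log 2 (y (h w)) = p w * (log 2 (mass S p f w) + log 2 (mass S p g w))"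
      using mass_pos[OF w, of f] mass_pos[OF w, of g] by (simp add: log_mult)
  qed
  also have "\<dots> = - (ent S p f + ent S p g)"
    by (simp add: ent_def distrib_left sum.distrib)
  also have "\<dots> = - ent S p h" using eq by (simp add: h_def[abs_def])
  finally have xy: "(\<Sum>i\<in>I. x i * log 2 (y i)) = (\<Sum>i\<in>I. x i * log 2 (x i))" by (simp add: ent_h)
  have x_nonneg: "x i \<ge> 0" for i
    unfolding xh by (intro sum_nonneg) (auto intro: less_imp_le[OF p_pos])
  have "(f v, g w) \<in> I" using v by (simp add: I_def)
  then have "x (f v, g w) = y (f v, g w)"
    using x_nonneg ypos sx sy
    by (intro gibbs_inequality(2)[OF I _ _ _ _ xy]) (auto intro: less_imp_le)
  then show ?thesis by (simp add: x_def y_def mass_def)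
qed

text \<open>Applied with the coordinates 2, 3, 4 as \<open>x\<close>, \<open>y\<close>,
  \<open>z\<close>. Fixing the value of \<open>x\<close>, each value of \<open>z\<close> yields a
  different value of \<open>y\<close>, all of the same probability as that of \<open>x\<close>;
  disjointness bounds their total by 1.\<close>

lemma log_card_le_ent:
  assumes xz: "ent S p (\<lambda>w. (x w, z w)) = ent S p x + ent S p z"
    and yz: "ent S p (\<lambda>w. (y w, z w)) = ent S p y + ent S p z"
    and xy: "\<And>v w. v \<in> S \<Longrightarrow> w \<in> S \<Longrightarrow> x v = x w \<Longrightarrow> y v = y w \<Longrightarrow> v = w"
    and det_xz: "\<And>v w. v \<in> S \<Longrightarrow> w \<in> S \<Longrightarrow> x v = x w \<Longrightarrow> z v = z w \<Longrightarrow> v = w"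
    and det_yz: "\<And>v w. v \<in> S \<Longrightarrow> w \<in> S \<Longrightarrow> y v = y w \<Longrightarrow> z v = z w \<Longrightarrow> v = w"
  shows "log 2 (card (z ` S)) \<le> ent S p x"
proof (rule ent_ge_log)
  show "0 < real (card (z ` S))" using finite_S S_nonempty by (simp add: card_gt_0_iff)
  \<comment> \<open>The outcome \<open>w\<close> is determined by \<open>(x, z)\<close> and also by
    \<open>(y, z)\<close>, so independence factors \<open>p w\<close> in two ways and the mass of
    \<open>z\<close> cancels.\<close>
  have prod: "mass S p x w = mass S p y w" if w: "w \<in> S" for w
  proof -
    have "{u \<in> S. x u = x w \<and> z u = z w} = {w}" "{u \<in> S. y u = y w \<and> z u = z w} = {w}"
      using det_xz det_yz w by blast+
    then have "mass S p x w * mass S p z w = mass S p y w * mass S p z w"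
      using ent_additive_imp_product[OF xz w w] ent_additive_imp_product[OF yz w w] by simp
    then show ?thesis using mass_pos[OF w, of z] by simp
  qed
  fix w assume w: "w \<in> S"
  \<comment> \<open>By independence every value of \<open>z\<close> occurs together with the value
    \<open>x w\<close>.\<close>
  have "\<exists>u\<in>S. x u = x w \<and> z u = c" if "c \<in> z ` S" for c
  proof -
    obtain v where v: "v \<in> S" "c = z v" using \<open>c \<in> z ` S\<close> by blast
    have "sum p {u \<in> S. x u = x w \<and> z u = z v} > 0"
      using ent_additive_imp_product[OF xz w v(1)] mass_pos[OF w, of x] mass_pos[OF v(1), of z]
      by simp
    then have "{u \<in> S. x u = x w \<and> z u = z v} \<noteq> {}" by (intro notI) simp
    then show ?thesis using v(2) by blast
  qed
  then obtain u where u: "\<And>c. c \<in> z ` S \<Longrightarrow> u c \<in> S \<and> x (u c) = x w \<and> z (u c) = c" by metis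
  \<comment> \<open>All \<open>u c\<close> share the same \<open>x\<close>, so a common
    \<open>y\<close> would make them the same outcome, hence with the same \<open>z\<close>.\<close>
  have inj: "inj_on (\<lambda>c. y (u c)) (z ` S)" using u xy by (intro inj_onI) metis
  have "real (card (z ` S)) * mass S p x w = (\<Sum>c\<in>z ` S. mass S p x w)" by simp
  also have "\<dots> = (\<Sum>c\<in>z ` S. sum p {v \<in> S. y v = y (u c)})"
  proof (intro sum.cong refl)
    fix c assume "c \<in> z ` S"
    then have "mass S p x w = mass S p x (u c)" "u c \<in> S" using u by (auto simp: mass_def)
    then show "mass S p x w = sum p {v \<in> S. y v = y (u c)}"
      using prod[of "u c"] by (simp add: mass_def)
  qed
  also have "\<dots> = (\<Sum>b\<in>(\<lambda>c. y (u c)) ` z ` S. sum p {v \<in> S. y v = b})"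
    by (simp add: sum.reindex[OF inj])
  also have "\<dots> \<le> (\<Sum>b\<in>y ` S. sum p {v \<in> S. y v = b})"
    using finite_S u by (intro sum_mono2) (auto intro!: sum_nonneg less_imp_le[OF p_pos])
  also have "\<dots> = 1" by (rule sum_image_eq_1)
  finally show "real (card (z ` S)) * mass S p x w \<le> 1" .
qed

end

section \<open>Distributions with prescribed entropy\<close>

lemma continuous_on_x_log_x: "continuous_on {0..} (\<lambda>x::real. x * log 2 x)"
  unfolding continuous_on_def
proof
  fix x :: real assume "x \<in> {0..}"
  then consider "x = 0" | "x > 0" by (metis atLeast_iff order_le_less)
  then show "((\<lambda>x. x * log 2 x) \<longlongrightarrow> x * log 2 x) (at x within {0..})"
  proof cases
    case 1
    have "((\<lambda>x::real. x * log 2 x) \<longlongrightarrow> 0) (at_right 0)"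
      unfolding log_def by real_asymp
    then show ?thesis using 1 by (simp add: at_within_Ici_at_right)
  next
    case 2
    then show ?thesis by (intro tendsto_intros) auto
  qed
qed

text \<open>Intermediate value theorem on the segment \<open>q t\<close> from the point mass at 0,
  of entropy 0, to the uniform distribution, of entropy \<open>log 2 n\<close>.\<close>

lemma exists_pmf_with_entropy:
  fixes n :: nat and h :: real
  assumes n: "n > 0" and h: "0 \<le> h" "h \<le> log 2 n"
  obtains q :: "nat \<Rightarrow> real"
  where "\<And>i. q i \<ge> 0" "sum q {..<n} = 1" "- (\<Sum>i<n. q i * log 2 (q i)) = h"
proof -
  define q where "q t i = (1 - t) * of_bool (i = 0) + t / n" for t :: real and i :: nat
  define E where "E t = - (\<Sum>i<n. q t i * log 2 (q t i))" for t
  have q: "q t i \<ge> 0" if "t \<in> {0..1}" for t i using that by (simp add: q_def)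
  have "continuous_on {0..1} (\<lambda>t. q t i * log 2 (q t i))" for i
  proof (rule continuous_on_compose2[OF continuous_on_x_log_x])
    show "continuous_on {0..1} (\<lambda>t. q t i)"
      unfolding q_def using n by (intro continuous_intros) auto
  qed (use q in auto)
  then have "continuous_on {0..1} E" 
    unfolding E_def by (intro continuous_on_minus continuous_on_sum)
  moreover have "E 0 = 0" by (auto simp: E_def q_def intro!: sum.neutral)
  moreover have "E 1 = log 2 n" using n by (simp add: E_def q_def log_divide)
  ultimately obtain t where t: "t \<in> {0..1}" "E t = h"
    using IVT'[of E 0 h 1] h by auto
  have "sum (q t) {..<n} = (1 - t) * (\<Sum>i<n. of_bool (i = 0)) + (\<Sum>i<n. t / n)"
    unfolding q_def by (simp add: sum.distrib sum_distrib_left)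
  also have "(\<Sum>i<n. of_bool (i = (0::nat))) = (1::real)" using n by (simp add: of_bool_def)
  finally have "sum (q t) {..<n} = 1" using n by simp
  then show ?thesis using that[of "q t"] q[OF t(1)] t(2) by (simp add: E_def)
qed

section \<open>Values on the face and necessity of the inequality\<close>

lemma restrict_eq_iff: "restrict f A = restrict g A \<longleftrightarrow> (\<forall>x\<in>A. f x = g x)"
proof
  assume eq: "restrict f A = restrict g A"
  show "\<forall>x\<in>A. f x = g x"
  proof
    fix x assume "x \<in> A"
    then show "f x = g x" using fun_cong[OF eq, of x] by simp
  qed
qed (auto intro: restrict_ext)

text \<open>The clauses cover every subset of \<open>N4\<close>. The sets in the last one have full
  rank, so their variables must determine the whole vector.\<close>

lemma face_point_simps:
  defines "h \<equiv> face_point Uhat_2_5_1 U_1_3_123"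
  shows "h a b {} = 0" "h a b {2} = a + b" "h a b {3} = a + b" "h a b {4} = a"
    and "1 \<in> A \<or> {2,3} \<subseteq> A \<or> {2,4} \<subseteq> A \<or> {3,4} \<subseteq> A \<Longrightarrow> A \<subseteq> N4 \<Longrightarrow> h a b A = 2 * a + b"
proof -
  show "h a b {} = 0" "h a b {2} = a + b" "h a b {3} = a + b" "h a b {4} = a"
    by (simp_all add: h_def face_point_def Uhat_2_5_1_def U_1_3_123_def)
  have "\<forall>A\<subseteq>N4. 1 \<in> A \<or> {2,3} \<subseteq> A \<or> {2,4} \<subseteq> A \<or> {3,4} \<subseteq> A \<longrightarrow> h a b A = 2 * a + b"
    unfolding all_subset_N4
    by (simp add: h_def face_point_def Uhat_2_5_1_def U_1_3_123_def Int_insert_left)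
  then show "1 \<in> A \<or> {2,3} \<subseteq> A \<or> {2,4} \<subseteq> A \<or> {3,4} \<subseteq> A \<Longrightarrow> A \<subseteq> N4 \<Longrightarrow> h a b A = 2 * a + b"
    by blast
qed

lemma entropic_imp_log_ceiling_le:
  assumes "entropic (face_point Uhat_2_5_1 U_1_3_123 a b)"
  shows "log 2 (real_of_int \<lceil>2 powr a\<rceil>) \<le> a + b"
proof -
  obtain S :: "(nat \<Rightarrow> nat) set" and p :: "(nat \<Rightarrow> nat) \<Rightarrow> real"
    where S: "finite S" "\<And>v. v \<in> S \<Longrightarrow> p v > 0" "sum p S = 1"
      and ext: "\<And>v w. v \<in> S \<Longrightarrow> w \<in> S \<Longrightarrow> (\<And>j. j \<in> N4 \<Longrightarrow> v j = w j) \<Longrightarrow> v = w"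
      and h: "\<And>A. A \<subseteq> N4 \<Longrightarrow>
        face_point Uhat_2_5_1 U_1_3_123 a b A = ent S p (\<lambda>v. \<lambda>j\<in>A. v j)"
    by (rule entropic_finite_support[OF assms]) blast
  interpret finite_pmf S p by standard (use S in auto)
  have single: "ent S p (\<lambda>v. \<lambda>j\<in>{i}. v j) = ent S p (\<lambda>v. v i)" for i
    by (rule ent_cong) (simp add: restrict_eq_iff)
  have pair: "ent S p (\<lambda>v. \<lambda>j\<in>{i,k}. v j) = ent S p (\<lambda>v. (v i, v k))" for i k
    by (rule ent_cong) (simp add: restrict_eq_iff)
  have e: "ent S p (\<lambda>v. v 2) = a + b" "ent S p (\<lambda>v. v 3) = a + b" "ent S p (\<lambda>v. v 4) = a"
    using h[of "{2}"] h[of "{3}"] h[of "{4}"] by (simp_all add: single face_point_simps)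
  have e': "ent S p (\<lambda>v. (v 2, v 3)) = 2 * a + b" "ent S p (\<lambda>v. (v 2, v 4)) = 2 * a + b"
    "ent S p (\<lambda>v. (v 3, v 4)) = 2 * a + b"
    using h[of "{2,3}"] h[of "{2,4}"] h[of "{3,4}"] by (simp_all add: pair face_point_simps)
  have "ent S p (\<lambda>v. \<lambda>j\<in>N4. v j) = 2 * a + b"
    using h[of N4] by (simp add: face_point_simps)
  moreover have "ent S p (\<lambda>v. \<lambda>j\<in>N4. v j) = ent S p (\<lambda>v. v)"
    using ext by (intro ent_cong) (auto simp: restrict_eq_iff)
  ultimately have all: "ent S p (\<lambda>v. v) = 2 * a + b" by simp
  have det: "v = w" if "ent S p (\<lambda>v. (v i, v k)) = 2 * a + b" "v \<in> S" "w \<in> S" "v i = w i" "v k = w k"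
    for i k v w
    using ent_eq_imp_determines[of "\<lambda>v. v" "\<lambda>v. (v i, v k)" v w] that all by simp
  define n where "n = card ((\<lambda>v. v 4) ` S)"
  have n0: "n > 0" unfolding n_def using finite_S S_nonempty by (simp add: card_gt_0_iff)
  have "a \<le> log 2 n" using ent_le_log_card[of "\<lambda>v. v 4"] e(3) by (simp add: n_def)
  \<comment> \<open>Since \<open>n\<close> is an integer, the bound passes to the ceiling.\<close>
  then have "2 powr a \<le> real_of_int (int n)" using n0 by (simp add: le_log_iff)
  then have "\<lceil>2 powr a\<rceil> \<le> int n" by (rule ceiling_le)
  then have "log 2 (real_of_int \<lceil>2 powr a\<rceil>) \<le> log 2 n"
    using n0 by (subst log_le_cancel_iff) (auto simp: less_ceiling_iff)
  also have "\<dots> \<le> ent S p (\<lambda>v. v 2)"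
    unfolding n_def
    by (rule log_card_le_ent[of _ _ "\<lambda>v. v 3"]) (use e e' det in auto)
  finally show ?thesis using e by simp
qed

section \<open>Construction of the random vector\<close>

lemma sum_triples:
  "(\<Sum>(z, u, c)\<in>A \<times> B \<times> C. g z u c) = (\<Sum>z\<in>A. \<Sum>u\<in>B. \<Sum>c\<in>C. g z u c)"
  by (simp add: sum.cartesian_product)

lemma mod_add_less:
  assumes "u < k" and "c < (k::nat)"
  shows "(u + c) mod k = (if u + c < k then u + c else u + c - k)"
  using assms by (simp add: le_mod_geq)

text \<open>Each \<open>c\<close> meets the diagonal in exactly one \<open>u\<close>. In the witness
  \<open>k\<close> is added before subtracting so that natural subtraction does not
  truncate.\<close>

lemma sum_mod_diagonal:
  assumes "v < (k::nat)"
  shows "(\<Sum>(u, c) | u < k \<and> c < k \<and> (u + c) mod k = v. g c) = (\<Sum>c<k. g c)"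
proof (rule sum.reindex_bij_witness[of _ "\<lambda>c. ((v + k - c) mod k, c)" snd])
  fix uc assume "uc \<in> {(u, c). u < k \<and> c < k \<and> (u + c) mod k = v}"
  then obtain u c where uc: "uc = (u, c)" "u < k" "c < k" "(u + c) mod k = v" by auto
  have "(v + k - c) mod k = u"
    using uc by (auto simp: mod_add_less split: if_splits)
  then show "((v + k - snd uc) mod k, snd uc) = uc" by (simp add: uc)
next
  fix c assume "c \<in> {..<k}"
  then show "((v + k - c) mod k, c) \<in> {(u, c). u < k \<and> c < k \<and> (u + c) mod k = v}"
    using assms by (auto simp: mod_add_left_eq)
qed auto

lemma log_ceiling_le_imp_entropic:
  assumes a: "a \<ge> 0" and ab: "log 2 (real_of_int \<lceil>2 powr a\<rceil>) \<le> a + b"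
  shows "entropic (face_point Uhat_2_5_1 U_1_3_123 a b)"
proof -
  define k where "k = nat \<lceil>2 powr a\<rceil>"
  \<comment> \<open>The entropy still missing from coordinates 2 and 3; the hypothesis says exactly
    that \<open>d \<ge> 0\<close>.\<close>
  define d where "d = a + b - log 2 k"
  define m where "m = nat \<lceil>2 powr d\<rceil>"
  have k0: "k > 0" by (simp add: k_def less_ceiling_iff)
  have m0: "m > 0" by (simp add: m_def less_ceiling_iff)
  have log_ceiling: "x \<le> log 2 (nat \<lceil>2 powr x\<rceil>)" for x :: real
    by (subst le_log_iff) (auto simp: less_ceiling_iff)
  have d0: "0 \<le> d" using ab by (simp add: d_def k_def less_ceiling_iff less_imp_le)
  obtain q where q: "\<And>i. q i \<ge> 0" "sum q {..<k} = 1" "- (\<Sum>i<k. q i * log 2 (q i)) = a"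
    using exists_pmf_with_entropy[OF k0 a] log_ceiling[of a] unfolding k_def by blast
  obtain s where s: "\<And>i. s i \<ge> 0" "sum s {..<m} = 1" "- (\<Sum>i<m. s i * log 2 (s i)) = d"
    using exists_pmf_with_entropy[OF m0 d0] log_ceiling[of d] unfolding m_def by blast
  define S where "S = {..<m} \<times> {..<k} \<times> {..<k}"
  \<comment> \<open>In an outcome \<open>(z, u, c)\<close> the parts are independent:
    \<open>z\<close> has law \<open>s\<close> and entropy \<open>d\<close>, \<open>u\<close> is
    uniform below \<open>k\<close>, and \<open>c\<close> has law \<open>q\<close> and entropy
    \<open>a\<close>.\<close>
  define p where "p = (\<lambda>(z, u::nat, c). s z * q c / k)"
  \<comment> \<open>Padding with zeros gives the four variables a common type.\<close>
  define Z where "Z j = (\<lambda>(z::nat, u, c).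
    if j = 1 then (z, u, c) else if j = 2 then (z, u, 0)
    else if j = 3 then (z, (u + c) mod k, 0) else (0, 0, c))" for j :: nat
  have Z: "Z 1 (z, u, c) = (z, u, c)" "Z 2 (z, u, c) = (z, u, 0)"
    "Z 3 (z, u, c) = (z, (u + c) mod k, 0)" "Z 4 (z, u, c) = (0, 0, c)" for z u c
    by (simp_all add: Z_def)
  have finS: "finite S" by (simp add: S_def)
  have p0: "p w \<ge> 0" for w using q s by (simp add: p_def split: prod.splits)
  \<comment> \<open>The logarithms of all masses needed below have the form
    \<open>f z + g c\<close>, independent of \<open>u\<close>, so one summation serves every
    entropy.\<close>
  have sum_S: "(\<Sum>(z, u, c)\<in>S. s z * q c / k * (f z + g c)) =
      (\<Sum>z<m. s z * f z) + (\<Sum>c<k. q c * g c)" for f g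
  proof -
    have "(\<Sum>(z, u, c)\<in>S. s z * q c / k * (f z + g c)) =
        (\<Sum>z<m. \<Sum>c<k. s z * q c * (f z + g c))"
      using k0 by (simp add: S_def sum_triples sum_divide_distrib[symmetric] sum_distrib_left[symmetric])
    also have "\<dots> = (\<Sum>z<m. s z * f z * (\<Sum>c<k. q c)) + (\<Sum>z<m. s z * (\<Sum>c<k. q c * g c))"
      by (simp add: sum_distrib_left sum.distrib algebra_simps)
    also have "\<dots> = (\<Sum>z<m. s z * f z) + (\<Sum>c<k. q c * g c)"
      using q(2) s(2) by (simp flip: sum_distrib_right)
    finally show ?thesis .
  qed
  have sum_p: "sum p S = 1"
    using sum_S[of "\<lambda>_. 1" "\<lambda>_. 0"] s(2) by (simp add: p_def)
  \<comment> \<open>The logarithm need only split where \<open>s z\<close> and \<open>q c\<close>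
    are positive, since other outcomes have weight 0.\<close>
  have ent_p: "ent S p h = - ((\<Sum>z<m. s z * f z) + (\<Sum>c<k. q c * g c))"
    if "\<And>z u c. (z, u, c) \<in> S \<Longrightarrow> s z > 0 \<Longrightarrow> q c > 0 \<Longrightarrow> log 2 (mass S p h (z, u, c)) = f z + g c"
    for h :: "nat \<times> nat \<times> nat \<Rightarrow> 'x" and f g
  proof -
    have "(\<Sum>w\<in>S. p w * log 2 (mass S p h w)) = (\<Sum>(z, u, c)\<in>S. s z * q c / k * (f z + g c))"
    proof (intro sum.cong refl, clarify)
      fix z u c assume w: "(z, u, c) \<in> S"
      show "p (z, u, c) * log 2 (mass S p h (z, u, c)) = s z * q c / k * (f z + g c)"
        using that[OF w] q(1)[of c] s(1)[of z] by (cases "s z = 0 \<or> q c = 0") (auto simp: p_def)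
    qed
    then show ?thesis using sum_S[of f g] by (simp only: ent_def)
  qed
  have ent_inj: "ent S p h = 2 * a + b" if "inj_on h S" for h :: "nat \<times> nat \<times> nat \<Rightarrow> nat \<Rightarrow> nat \<times> nat \<times> nat"
  proof -
    have "mass S p h w = p w" if "w \<in> S" for w
    proof -
      have "{w' \<in> S. h w' = h w} = {w}" using \<open>inj_on h S\<close> that by (auto dest: inj_onD)
      then show ?thesis by (simp add: mass_def)
    qed
    then have "ent S p h = - ((\<Sum>z<m. s z * log 2 (s z)) + (\<Sum>c<k. q c * (log 2 (q c) - log 2 k)))"
      using k0 by (intro ent_p) (simp add: p_def log_mult log_divide)
    also have "\<dots> = d + a + log 2 k"
      using q s by (simp add: right_diff_distrib sum_subtractf flip: sum_distrib_right)
    finally show ?thesis by (simp add: d_def)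
  qed
  have ent_2: "ent S p (Z 2) = a + b"
  proof -
    have "mass S p (Z 2) (z, u, c) = s z / k" if "(z, u, c) \<in> S" for z u c
    proof -
      have "{w' \<in> S. Z 2 w' = Z 2 (z, u, c)} = {z} \<times> {u} \<times> {..<k}"
        using that by (auto simp: S_def Z)
      then have "mass S p (Z 2) (z, u, c) = (\<Sum>(z, u, c)\<in>{z} \<times> {u} \<times> {..<k}. s z * q c / k)"
        by (simp add: mass_def p_def)
      also have "\<dots> = s z / k"
        unfolding sum_triples using q(2) by (simp flip: sum_divide_distrib sum_distrib_left)
      finally show ?thesis .
    qed
    then have "ent S p (Z 2) = - ((\<Sum>z<m. s z * (log 2 (s z) - log 2 k)) + (\<Sum>c<k. q c * 0))"
      using k0 by (intro ent_p) (simp add: log_divide)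
    also have "\<dots> = d + log 2 k"
      using s by (simp add: right_diff_distrib sum_subtractf flip: sum_distrib_right)
    finally show ?thesis by (simp add: d_def)
  qed
  have ent_3: "ent S p (Z 3) = a + b"
  proof -
    have "mass S p (Z 3) (z, u, c) = s z / k" if "(z, u, c) \<in> S" for z u c
    proof -
      define v where "v = (u + c) mod k"
      \<comment> \<open>For fixed \<open>z\<close> the fibre is a diagonal modulo \<open>k\<close>
        containing each \<open>c\<close> once, so \<open>q\<close> sums out to 1 and the shifted
        value stays uniform.\<close>
      have "{w' \<in> S. Z 3 w' = Z 3 (z, u, c)} =
          Pair z ` {(u, c). u < k \<and> c < k \<and> (u + c) mod k = v}"
        using that by (auto simp: S_def Z v_def)
      then have "mass S p (Z 3) (z, u, c) =
          (\<Sum>(u, c) | u < k \<and> c < k \<and> (u + c) mod k = v. s z * q c / k)"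
        by (simp add: mass_def p_def sum.reindex inj_on_def case_prod_unfold)
      also have "\<dots> = (\<Sum>c<k. s z * q c / k)" using k0 by (intro sum_mod_diagonal) (simp add: v_def)
      also have "\<dots> = s z / k"
        using q(2) by (simp flip: sum_divide_distrib sum_distrib_left)
      finally show ?thesis .
    qed
    then have "ent S p (Z 3) = - ((\<Sum>z<m. s z * (log 2 (s z) - log 2 k)) + (\<Sum>c<k. q c * 0))"
      using k0 by (intro ent_p) (simp add: log_divide)
    also have "\<dots> = d + log 2 k"
      using s by (simp add: right_diff_distrib sum_subtractf flip: sum_distrib_right)
    finally show ?thesis by (simp add: d_def)
  qed
  have ent_4: "ent S p (Z 4) = a"
  proof -
    have "mass S p (Z 4) (z, u, c) = q c" if "(z, u, c) \<in> S" for z u c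
    proof -
      have "{w' \<in> S. Z 4 w' = Z 4 (z, u, c)} = {..<m} \<times> {..<k} \<times> {c}"
        using that by (auto simp: S_def Z)
      then have "mass S p (Z 4) (z, u, c) = (\<Sum>(z, u, c)\<in>{..<m} \<times> {..<k} \<times> {c}. s z * q c / k)"
        by (simp add: mass_def p_def)
      also have "\<dots> = q c"
        unfolding sum_triples using s(2) k0 by (simp flip: sum_divide_distrib sum_distrib_right)
      finally show ?thesis .
    qed
    then have "ent S p (Z 4) = - ((\<Sum>z<m. s z * 0) + (\<Sum>c<k. q c * log 2 (q c)))"
      by (intro ent_p) simp
    then show ?thesis using q by simp
  qed
  have cancel: "u = u'" if "(u + c) mod k = (u' + c) mod k" "u < k" "u' < k" "c < k" for u u' c
    using that by (auto simp: mod_add_less split: if_splits)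
  have cancel': "c = c'" if "(u + c) mod k = (u + c') mod k" "u < k" "c < k" "c' < k" for u c c'
    using that by (auto simp: mod_add_less split: if_splits)
  \<comment> \<open>Two of \<open>u\<close>, \<open>c\<close> and \<open>(u + c) mod k\<close>
    determine the third, and coordinate 2 or 3 supplies \<open>z\<close>.\<close>
  have inj: "inj_on (\<lambda>w. \<lambda>j\<in>A. Z j w) S"
    if A: "1 \<in> A \<or> {2,3} \<subseteq> A \<or> {2,4} \<subseteq> A \<or> {3,4} \<subseteq> A" for A
  proof (rule inj_onI)
    fix v w
    assume vw: "v \<in> S" "w \<in> S" "(\<lambda>j\<in>A. Z j v) = (\<lambda>j\<in>A. Z j w)"
    obtain z u c z' u' c' where v: "v = (z, u, c)" and w: "w = (z', u', c')"
      by (cases v, cases w)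
    have "(\<lambda>j\<in>A. Z j (z, u, c)) = (\<lambda>j\<in>A. Z j (z', u', c'))" using vw(3) by (simp only: v w)
    then have eq: "Z j (z, u, c) = Z j (z', u', c')" if "j \<in> A" for j
      using that unfolding restrict_eq_iff by blast
    have lt: "u < k" "u' < k" "c < k" "c' < k" using vw by (auto simp: S_def v w)
    have e1: "z = z' \<and> u = u' \<and> c = c'" if "1 \<in> A" using eq[OF that] unfolding Z by simp
    have e2: "z = z' \<and> u = u'" if "2 \<in> A" using eq[OF that] by (simp add: Z)
    have e3: "z = z' \<and> (u + c) mod k = (u' + c') mod k" if "3 \<in> A" using eq[OF that] by (simp add: Z)
    have e4: "c = c'" if "4 \<in> A" using eq[OF that] by (simp add: Z)
    from A consider "1 \<in> A" | "2 \<in> A" "3 \<in> A" | "2 \<in> A" "4 \<in> A" | "3 \<in> A" "4 \<in> A"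
      by (auto simp only: insert_subset)
    then have "z = z' \<and> u = u' \<and> c = c'"
    proof cases
      case 2
      then show ?thesis using e2 e3 cancel'[of u c c'] lt by simp
    next
      case 4
      then show ?thesis using e3 e4 cancel[of u c u'] lt by simp
    qed (use e1 e2 e4 in auto)
    then show "v = w" by (simp add: v w)
  qed
  have single: "ent S p (\<lambda>w. \<lambda>j\<in>{i}. Z j w) = ent S p (Z i)" for i
    by (rule ent_cong) (simp add: restrict_eq_iff)
  have empty: "ent S p (\<lambda>w. \<lambda>j\<in>{}. Z j w) = 0"
    by (rule ent_const[OF sum_p]) (simp add: restrict_eq_iff)
  have "face_point Uhat_2_5_1 U_1_3_123 a b A = ent S p (\<lambda>w. \<lambda>j\<in>A. Z j w)" if A: "A \<subseteq> N4" for A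
  proof (cases "1 \<in> A \<or> {2,3} \<subseteq> A \<or> {2,4} \<subseteq> A \<or> {3,4} \<subseteq> A")
    case True
    then show ?thesis using ent_inj[OF inj] face_point_simps(5)[of A] A by simp
  next
    case False
    then have "A = {} \<or> A = {2} \<or> A = {3} \<or> A = {4}" using A by blast
    then show ?thesis
      using ent_2 ent_3 ent_4 single empty face_point_simps(1-4) by metis
  qed
  then show ?thesis using entropic_ent[OF finS p0 sum_p] by blast
qed

theorem mainTheorem7:
  fixes a b :: real
  assumes "a \<ge> 0" and "b \<ge> 0"
  shows "entropic (face_point Uhat_2_5_1 U_1_3_123 a b) \<longleftrightarrow>
    a + b \<ge> log 2 (real_of_int \<lceil>2 powr a\<rceil>)"
  using entropic_imp_log_ceiling_le log_ceiling_le_imp_entropic[OF assms(1)] by blast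

end
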